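(* Let $\mathsf{M}$ be the set of all $f\in \mathsf{C}([0,\omega_1])$ that are monotone non-increasing with $f(0)=1$ and $f(\omega_1)=0$. Let $\mathcal{U}$ be a uniform structure on $\mathsf{M}$ such that (1) the sup-norm topology on $\mathsf{M}$ is compatible with $\mathcal{U}$ (i.e. the topology induced by $\mathcal{U}$ is the topology of the metric $\|f-g\|$); (2) the uniformity on $\mathsf{M}$ defined by the metric $\|f-g\|$ is finer than $\mathcal{U}$; and (3) $\mathcal{U}$ has a uniformity basis consisting of point-finite covers. Then $\mathcal{U}$ is not complete.
   Context: $\mathsf{C}([0,\omega_1])$ is the Banach space of continuous real-valued functions on the compact ordinal space $[0,\omega_1]$ (order topology, $\omega_1$ the first uncountable ordinal), with the sup norm $\|\cdot\|$. Uniform structures are described by uniform covers: a uniformity basis of covers is a set of uniform covers such that every uniform cover is refined by a member of the set. A cover is point-finite if every point belongs to only finitely many members of the cover. "Finer than" is not meant strictly: the metric uniformity is finer than $\mathcal{U}$ if every $\mathcal{U}$-uniform cover is a uniform cover for the metric. A uniform structure is complete if every Cauchy filter converges. *)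

theory Defs
  imports "HOL-Analysis.Analysis"
begin

section \<open>The ordinal space \<open>[0, \<omega>\<^sub>1]\<close>\<close>

text \<open>
  The first uncountable ordinal is the cardinal successor of \<open>\<aleph>\<^sub>0\<close>; the elements of the
  well-order \<^term>\<open>cardSuc natLeq\<close> are the countable ordinals, i.e. the points of \<open>[0, \<omega>\<^sub>1)\<close>.
\<close>

typedef countable_ordinal = "Field (cardSuc natLeq)"
proof -
  have "cardSuc natLeq \<noteq> ({} :: nat set rel)"
    using cardSuc_greater[OF natLeq_Card_order] ordLess_imp_ordLeq
      cardSuc_finite[OF natLeq_Card_order] Field_natLeq
    by (metis Field_empty finite.emptyI infinite_UNIV_nat)
  then show ?thesis by (auto simp: Field_def)
qed

lemma wo_cardSuc: "Well_order (cardSuc natLeq)"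
  using cardSuc_Card_order[OF natLeq_Card_order] by (simp add: card_order_on_def)

instantiation countable_ordinal :: wellorder
begin

definition less_eq_countable_ordinal :: "countable_ordinal \<Rightarrow> countable_ordinal \<Rightarrow> bool"
  where "a \<le> b \<longleftrightarrow> (Rep_countable_ordinal a, Rep_countable_ordinal b) \<in> cardSuc natLeq"
  for a b :: countable_ordinal

definition less_countable_ordinal :: "countable_ordinal \<Rightarrow> countable_ordinal \<Rightarrow> bool"
  where "a < b \<longleftrightarrow> a \<le> b \<and> a \<noteq> b" for a b :: countable_ordinal

instance
proof
  have "refl_on (Field (cardSuc natLeq)) (cardSuc natLeq)"
    and tr: "trans (cardSuc natLeq)" and an: "antisym (cardSuc natLeq)"
    and tot: "total_on (Field (cardSuc natLeq)) (cardSuc natLeq)"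
    using wo_cardSuc by (simp_all add: order_on_defs)
  note rf = refl_onD[OF this(1)]
  fix a b c :: countable_ordinal
  show refl: "a \<le> a"
    unfolding less_eq_countable_ordinal_def by (rule rf) (rule Rep_countable_ordinal)
  show anti: "a \<le> b \<Longrightarrow> b \<le> a \<Longrightarrow> a = b"
    unfolding less_eq_countable_ordinal_def
    by (rule iffD1[OF Rep_countable_ordinal_inject], rule antisymD[OF an])
  then show "a < b \<longleftrightarrow> a \<le> b \<and> \<not> b \<le> a"
    using refl unfolding less_countable_ordinal_def by auto
  show "a \<le> b \<Longrightarrow> b \<le> c \<Longrightarrow> a \<le> c"
    unfolding less_eq_countable_ordinal_def by (rule transD[OF tr])
  show "a \<le> b \<or> b \<le> a"
  proof (cases "a = b")
    case False
    then show ?thesis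
      unfolding less_eq_countable_ordinal_def
      using tot[unfolded total_on_def] Rep_countable_ordinal
      by (simp add: Rep_countable_ordinal_inject)
  qed (use refl in simp)
next
  fix P :: "countable_ordinal \<Rightarrow> bool" and a
  assume IH: "\<And>x. (\<And>y. y < x \<Longrightarrow> P y) \<Longrightarrow> P x"
  have "wf {(x, y :: countable_ordinal). x < y}"
  proof (rule wf_subset[OF wf_inv_image])
    show "wf (cardSuc natLeq - Id :: nat set rel)"
      using wo_cardSuc by (simp add: well_order_on_def)
    show "{(x, y). x < y} \<subseteq> inv_image (cardSuc natLeq - Id) Rep_countable_ordinal"
      by (auto simp: less_eq_countable_ordinal_def less_countable_ordinal_def
          Rep_countable_ordinal_inject)
  qed
  then show "P a" using IH by (induction a) auto
qed

end

text \<open>The closed interval \<open>[0, \<omega>\<^sub>1]\<close> in its order topology, with \<open>bot = 0\<close> and \<open>top = \<omega>\<^sub>1\<close>.\<close>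

datatype ord_upto_omega1 = Below countable_ordinal | Omega1

instantiation ord_upto_omega1 :: "{wellorder, order_bot, order_top}"
begin

fun less_eq_ord_upto_omega1 :: "ord_upto_omega1 \<Rightarrow> ord_upto_omega1 \<Rightarrow> bool" where
  "Below a \<le> Below b \<longleftrightarrow> a \<le> b"
| "Omega1 \<le> Below b \<longleftrightarrow> False"
| "x \<le> Omega1 \<longleftrightarrow> True"

definition less_ord_upto_omega1 :: "ord_upto_omega1 \<Rightarrow> ord_upto_omega1 \<Rightarrow> bool"
  where "x < y \<longleftrightarrow> x \<le> y \<and> \<not> y \<le> x" for x y :: ord_upto_omega1

definition bot_ord_upto_omega1 :: ord_upto_omega1
  where "bot = Below (LEAST a. True)"

definition top_ord_upto_omega1 :: ord_upto_omega1
  where "top = Omega1"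

instance
proof
  fix a b c :: ord_upto_omega1
  show "a < b \<longleftrightarrow> a \<le> b \<and> \<not> b \<le> a" by (rule less_ord_upto_omega1_def)
  show "a \<le> a" by (cases a) auto
  show "a \<le> b \<Longrightarrow> b \<le> c \<Longrightarrow> a \<le> c" by (cases a; cases b; cases c) auto
  show "a \<le> b \<Longrightarrow> b \<le> a \<Longrightarrow> a = b" by (cases a; cases b) auto
  show "a \<le> b \<or> b \<le> a" by (cases a; cases b) auto
  show "bot \<le> a" by (cases a) (auto simp: bot_ord_upto_omega1_def intro: Least_le)
  show "a \<le> top" by (cases a) (auto simp: top_ord_upto_omega1_def)
next
  fix P :: "ord_upto_omega1 \<Rightarrow> bool" and a
  assume IH: "\<And>x. (\<And>y. y < x \<Longrightarrow> P y) \<Longrightarrow> P x"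
  have below: "P (Below b)" for b
  proof (induction b rule: less_induct)
    case (less b)
    show ?case
    proof (rule IH)
      fix y assume "y < Below b"
      then show "P y" using less
        by (cases y) (auto simp: less_ord_upto_omega1_def not_le)
    qed
  qed
  have "P Omega1"
  proof (rule IH)
    fix y assume "y < Omega1"
    then show "P y" using below by (cases y) (auto simp: less_ord_upto_omega1_def)
  qed
  then show "P a" using below by (cases a) auto
qed

end

instantiation ord_upto_omega1 :: linorder_topology
begin

definition open_ord_upto_omega1 :: "ord_upto_omega1 set \<Rightarrow> bool"
  where "open_ord_upto_omega1 =
    generate_topology (range (\<lambda>a. {..<a}) \<union> range (\<lambda>a. {a<..}))"

instance by standard (rule open_ord_upto_omega1_def)

end

lemma less_top_iff_Below: "x < top \<longleftrightarrow> (\<exists>a. x = Below a)" for x :: ord_upto_omega1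
  by (cases x) (auto simp: top_ord_upto_omega1_def less_ord_upto_omega1_def)

lemma countable_iff_le_natLeq:
  includes cardinal_syntax
  shows "countable A \<longleftrightarrow> |A| \<le>o natLeq"
proof -
  have "countable A \<longleftrightarrow> |A| \<le>o |UNIV :: nat set|"
    unfolding countable_def card_of_ordLeq[symmetric] by simp
  then show ?thesis
    using card_of_nat ordLeq_ordIso_trans ordIso_symmetric by blast
qed

text \<open>
  \<open>top\<close> really is the first uncountable ordinal: it has uncountably many predecessors,
  and every other point has only countably many.
\<close>

lemma uncountable_below_top:
  includes cardinal_syntax
  shows "uncountable {..<top :: ord_upto_omega1}"
proof
  assume "countable {..<top :: ord_upto_omega1}"
  moreover have "{..<top} = Below ` UNIV" by (auto simp: less_top_iff_Below)
  ultimately have "countable (Below ` UNIV)" by simp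
  then have "countable (UNIV :: countable_ordinal set)"
    by (rule countable_image_inj_on) (auto intro: injI)
  then have "countable (range Rep_countable_ordinal)" by simp
  then have "countable (Field (cardSuc natLeq))"
    by (simp add: type_definition.Rep_range[OF type_definition_countable_ordinal])
  then have "|Field (cardSuc natLeq)| \<le>o natLeq"
    using countable_iff_le_natLeq by blast
  then have "cardSuc natLeq \<le>o natLeq"
    using card_of_Field_ordIso[OF cardSuc_Card_order[OF natLeq_Card_order]]
      ordIso_ordLeq_trans ordIso_symmetric by blast
  then show False
    using cardSuc_greater[OF natLeq_Card_order] not_ordLess_ordLeq by blast
qed

lemma countable_below:
  includes cardinal_syntax
  fixes x :: ord_upto_omega1
  assumes "x < top"
  shows "countable {..<x}"
proof -
  obtain a where a: "x = Below a" using assms less_top_iff_Below by blast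
  let ?r = "cardSuc natLeq" and ?S = "underS (cardSuc natLeq) (Rep_countable_ordinal a)"
  have "|?S| <o ?r"
    using card_of_underS[OF cardSuc_Card_order[OF natLeq_Card_order] Rep_countable_ordinal] .
  then have "|?S| \<le>o natLeq"
    using cardSuc_ordLeq_ordLess[OF natLeq_Card_order card_of_Card_order] by blast
  then have "countable ?S" using countable_iff_le_natLeq by blast
  moreover have "{..<x} \<subseteq> (Below \<circ> Abs_countable_ordinal) ` ?S"
  proof
    fix y assume "y \<in> {..<x}"
    then obtain b where b: "y = Below b" "b < a"
      using a by (cases y) (auto simp: less_ord_upto_omega1_def)
    then have "Rep_countable_ordinal b \<in> ?S"
      by (auto simp: underS_def less_eq_countable_ordinal_def less_countable_ordinal_def
          Rep_countable_ordinal_inject)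
    then show "y \<in> (Below \<circ> Abs_countable_ordinal) ` ?S"
      using b by (auto simp: image_iff Rep_countable_ordinal_inverse
          intro!: bexI[of _ "Rep_countable_ordinal b"])
  qed
  ultimately show ?thesis using countable_subset by blast
qed

lemma compact_UNIV_ord_upto_omega1: "compact (UNIV :: ord_upto_omega1 set)"
proof (rule compactI)
  fix C :: "ord_upto_omega1 set set"
  assume op: "\<forall>T\<in>C. open T" and cov: "UNIV \<subseteq> \<Union>C"
  have "\<exists>D\<subseteq>C. finite D \<and> {..x} \<subseteq> \<Union>D" for x
  proof (induction x rule: less_induct)
    case (less x)
    obtain T where T: "T \<in> C" "x \<in> T" using cov by blast
    show ?case
    proof (cases "\<exists>y. y < x")
      case True
      then obtain y where y: "y < x" "{y<..x} \<subseteq> T"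
        using open_left[of T x] T op by blast
      from less[OF y(1)] obtain D where D: "D \<subseteq> C" "finite D" "{..y} \<subseteq> \<Union>D" by blast
      have "{..x} \<subseteq> \<Union>(insert T D)"
      proof
        fix z assume "z \<in> {..x}"
        then show "z \<in> \<Union>(insert T D)"
          using y(2) D(3) by (cases "z \<le> y") auto
      qed
      then show ?thesis using D T by (intro exI[of _ "insert T D"]) auto
    next
      case False
      then have "{..x} = {x}" by (auto simp: order.order_iff_strict)
      then show ?thesis using T by (intro exI[of _ "{T}"]) auto
    qed
  qed
  moreover have "{..top :: ord_upto_omega1} = UNIV" by auto
  ultimately show "\<exists>D\<subseteq>C. finite D \<and> UNIV \<subseteq> \<Union>D" by metis
qed

text \<open>
  Since \<open>[0, \<omega>\<^sub>1]\<close> is compact, the bounded continuous functions with the sup norm are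
  all of \<open>C([0, \<omega>\<^sub>1])\<close>.
\<close>

lemma continuous_imp_bcontfun:
  fixes f :: "ord_upto_omega1 \<Rightarrow> real"
  assumes "continuous_on UNIV f"
  shows "f \<in> bcontfun"
  using assms compact_imp_bounded[OF
      compact_continuous_image[OF assms compact_UNIV_ord_upto_omega1]]
  by (simp add: bcontfun_def)

definition M :: "(ord_upto_omega1 \<Rightarrow>\<^sub>C real) set"
  where "M = {f. antimono (apply_bcontfun f) \<and> f bot = 1 \<and> f top = 0}"


section \<open>Uniform structures given by uniform covers\<close>

definition cover_of :: "'a set \<Rightarrow> 'a set set \<Rightarrow> bool"
  where "cover_of X C \<longleftrightarrow> \<Union>C = X"

definition refines :: "'a set set \<Rightarrow> 'a set set \<Rightarrow> bool"
  where "refines D C \<longleftrightarrow> (\<forall>A\<in>D. \<exists>B\<in>C. A \<subseteq> B)"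

definition star_of :: "'a set \<Rightarrow> 'a set set \<Rightarrow> 'a set"
  where "star_of A C = \<Union>{B \<in> C. A \<inter> B \<noteq> {}}"

definition star_refines :: "'a set set \<Rightarrow> 'a set set \<Rightarrow> bool"
  where "star_refines D C \<longleftrightarrow> (\<forall>A\<in>D. \<exists>B\<in>C. star_of A D \<subseteq> B)"

text \<open>A uniform structure on \<open>X\<close> is the set \<open>U\<close> of its uniform covers (Tukey, Isbell).\<close>

definition uniform_structure_on :: "'a set \<Rightarrow> 'a set set set \<Rightarrow> bool"
  where "uniform_structure_on X U \<longleftrightarrow>
    U \<noteq> {} \<and>
    (\<forall>C\<in>U. cover_of X C) \<and>
    (\<forall>C D. D \<in> U \<longrightarrow> cover_of X C \<longrightarrow> refines D C \<longrightarrow> C \<in> U) \<and>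
    (\<forall>C\<in>U. \<forall>D\<in>U. \<exists>E\<in>U. star_refines E C \<and> star_refines E D)"

definition uniform_topology :: "'a set \<Rightarrow> 'a set set set \<Rightarrow> 'a topology"
  where "uniform_topology X U =
    topology (\<lambda>S. S \<subseteq> X \<and> (\<forall>x\<in>S. \<exists>C\<in>U. star_of {x} C \<subseteq> S))"

definition uniformity_basis :: "'a set set set \<Rightarrow> 'a set set set \<Rightarrow> bool"
  where "uniformity_basis U B \<longleftrightarrow> B \<subseteq> U \<and> (\<forall>C\<in>U. \<exists>D\<in>B. refines D C)"

definition point_finite :: "'a set \<Rightarrow> 'a set set \<Rightarrow> bool"
  where "point_finite X C \<longleftrightarrow> (\<forall>x\<in>X. finite {A \<in> C. x \<in> A})"

definition finer_uniform_structure :: "'a set set set \<Rightarrow> 'a set set set \<Rightarrow> bool"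
  where "finer_uniform_structure V U \<longleftrightarrow> U \<subseteq> V"

definition metric_uniform_structure :: "'a::metric_space set \<Rightarrow> 'a set set set"
  where "metric_uniform_structure X =
    {C. cover_of X C \<and> (\<exists>e>0. \<forall>x\<in>X. \<exists>A\<in>C. X \<inter> ball x e \<subseteq> A)}"

text \<open>
  Proper filters on \<open>X\<close> are represented by the filters on the ambient type that contain \<open>X\<close>.
\<close>

definition cauchy_filter_on :: "'a set \<Rightarrow> 'a set set set \<Rightarrow> 'a filter \<Rightarrow> bool"
  where "cauchy_filter_on X U F \<longleftrightarrow>
    F \<noteq> bot \<and> F \<le> principal X \<and> (\<forall>C\<in>U. \<exists>A\<in>C. \<forall>\<^sub>F x in F. x \<in> A)"

definition complete_uniform_structure :: "'a set \<Rightarrow> 'a set set set \<Rightarrow> bool"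
  where "complete_uniform_structure X U \<longleftrightarrow>
    (\<forall>F. cauchy_filter_on X U F \<longrightarrow> (\<exists>l. limitin (uniform_topology X U) (\<lambda>x. x) l F))"


subsection \<open>Sanity checks\<close>

lemma openin_uniform_topology:
  assumes U: "uniform_structure_on X U"
  shows "openin (uniform_topology X U) S \<longleftrightarrow>
    S \<subseteq> X \<and> (\<forall>x\<in>S. \<exists>C\<in>U. star_of {x} C \<subseteq> S)"
proof -
  have star_mono: "star_of {x} E \<subseteq> star_of {x} C" if sr: "star_refines E C" for x :: 'a and E C
  proof
    fix y assume "y \<in> star_of {x} E"
    then obtain A where A: "A \<in> E" "x \<in> A" "y \<in> A" by (auto simp: star_of_def)
    then obtain B where "B \<in> C" "star_of A E \<subseteq> B"
      using sr by (auto simp: star_refines_def)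
    moreover have "A \<subseteq> star_of A E" using A by (auto simp: star_of_def)
    ultimately show "y \<in> star_of {x} C" using A by (auto simp: star_of_def)
  qed
  have "istopology (\<lambda>S. S \<subseteq> X \<and> (\<forall>x\<in>S. \<exists>C\<in>U. star_of {x} C \<subseteq> S))"
    unfolding istopology_def
  proof (intro conjI allI impI)
    fix S T
    assume S: "S \<subseteq> X \<and> (\<forall>x\<in>S. \<exists>C\<in>U. star_of {x} C \<subseteq> S)"
      and T: "T \<subseteq> X \<and> (\<forall>x\<in>T. \<exists>C\<in>U. star_of {x} C \<subseteq> T)"
    show "S \<inter> T \<subseteq> X" using S by blast
    show "\<forall>x\<in>S \<inter> T. \<exists>C\<in>U. star_of {x} C \<subseteq> S \<inter> T"
    proof
      fix x assume "x \<in> S \<inter> T"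
      then obtain C D where CD: "C \<in> U" "star_of {x} C \<subseteq> S" "D \<in> U" "star_of {x} D \<subseteq> T"
        using S T by blast
      then obtain E where E: "E \<in> U" "star_refines E C" "star_refines E D"
        using U unfolding uniform_structure_on_def by meson
      then show "\<exists>C\<in>U. star_of {x} C \<subseteq> S \<inter> T"
        using CD star_mono[OF E(2), of x] star_mono[OF E(3), of x] by blast
    qed
  next
    fix K
    assume "\<forall>S\<in>K. S \<subseteq> X \<and> (\<forall>x\<in>S. \<exists>C\<in>U. star_of {x} C \<subseteq> S)"
    then show "\<Union>K \<subseteq> X" "\<forall>x\<in>\<Union>K. \<exists>C\<in>U. star_of {x} C \<subseteq> \<Union>K"
      by (blast, meson Union_iff Union_upper subset_trans)
  qed
  then show ?thesis unfolding uniform_topology_def by (simp add: topology_inverse')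
qed

lemma uniform_structure_on_metric:
  fixes X :: "'a::metric_space set"
  shows "uniform_structure_on X (metric_uniform_structure X)"
  unfolding uniform_structure_on_def
proof (intro conjI allI impI ballI)
  have "{X} \<in> metric_uniform_structure X"
    by (auto simp: metric_uniform_structure_def cover_of_def intro: exI[of _ 1])
  then show "metric_uniform_structure X \<noteq> {}" by blast
next
  fix C assume "C \<in> metric_uniform_structure X"
  then show "cover_of X C" by (simp add: metric_uniform_structure_def)
next
  fix C D assume "D \<in> metric_uniform_structure X" "cover_of X C" "refines D C"
  then show "C \<in> metric_uniform_structure X"
    unfolding metric_uniform_structure_def refines_def mem_Collect_eq
    by (meson subset_trans)
next
  fix C D assume "C \<in> metric_uniform_structure X" "D \<in> metric_uniform_structure X"
  then obtain c d where c: "c > 0" "\<forall>x\<in>X. \<exists>A\<in>C. X \<inter> ball x c \<subseteq> A"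
    and d: "d > 0" "\<forall>x\<in>X. \<exists>A\<in>D. X \<inter> ball x d \<subseteq> A"
    by (auto simp: metric_uniform_structure_def)
  define e where "e = min c d / 4"
  have e: "e > 0" "4 * e \<le> c" "4 * e \<le> d" using c d by (auto simp: e_def)
  define E where "E = (\<lambda>x. X \<inter> ball x e) ` X"
  have star: "star_of (X \<inter> ball x e) E \<subseteq> X \<inter> ball x (4 * e)" for x
  proof
    fix z assume "z \<in> star_of (X \<inter> ball x e) E"
    then obtain y w where "z \<in> X" "dist y z < e" "dist y w < e" "dist x w < e"
      by (auto simp: star_of_def E_def)
    moreover have "dist x z \<le> dist x w + dist w y + dist y z"
      by (meson add_mono dist_triangle dist_triangle_le order_refl order_trans)
    ultimately show "z \<in> X \<inter> ball x (4 * e)" using e by (simp add: dist_commute)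
  qed
  have "star_refines E C'" if C': "\<forall>x\<in>X. \<exists>A\<in>C'. X \<inter> ball x c' \<subseteq> A" "4 * e \<le> c'" for C' c'
    unfolding star_refines_def
  proof
    fix A assume "A \<in> E"
    then obtain x where x: "x \<in> X" "A = X \<inter> ball x e" by (auto simp: E_def)
    then obtain B where "B \<in> C'" "X \<inter> ball x c' \<subseteq> B" using C'(1) by blast
    moreover have "ball x (4 * e) \<subseteq> ball x c'" using C'(2) by (rule subset_ball)
    ultimately show "\<exists>B\<in>C'. star_of A E \<subseteq> B" using star[of x] x by blast
  qed
  moreover have "E \<in> metric_uniform_structure X"
    unfolding metric_uniform_structure_def cover_of_def E_def using e by fastforce
  ultimately show "\<exists>E\<in>metric_uniform_structure X. star_refines E C \<and> star_refines E D"
    using c d e by blast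
qed

end

theory Submission
  imports Defs
begin

text \<open>
  Let \<open>p\<close> be an ultrafilter on \<open>\<omega>\<^sub>1\<close> containing all tails, and for countable ordinals
  \<open>b\<^sub>1 \<le> \<dots> \<le> b\<^sub>n\<close> let \<open>step [b\<^sub>1, \<dots>, b\<^sub>n] \<in> M\<close> be the average of the indicators of the clopen
  intervals \<open>[0, b\<^sub>i]\<close>. Interlaced sequences yield step functions at distance at most \<open>1/n\<close>.
  Given a point-finite cover with Lebesgue number above \<open>1/n\<close>, select for each \<open>step bs\<close> a
  member containing the ball around it. This member is the same for \<open>p\<close>-almost all \<open>b\<^sub>1\<close>,
  \<open>p\<close>-almost all \<open>b\<^sub>2\<close>, and so on up to \<open>b\<^sub>n\<close>: eliminating the last variables first, if infinitely
  many values occurred in one variable, then countably many of them could be realized by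
  sequences interlaced with a single one, because countable sets of countable ordinals are
  bounded, and this contradicts point-finiteness. Hence the iterated limits along \<open>p\<close> of the
  step functions with \<open>2\<^sup>k\<close> steps, \<open>k \<rightarrow> \<infinity>\<close>, form a Cauchy filter. It cannot converge in \<open>M\<close>:
  every function in \<open>M\<close> is less than \<open>1/2\<close> at some countable ordinal, where almost all of these
  step functions take the value \<open>1\<close>.
\<close>

section \<open>Filters\<close>

text \<open>Zorn's lemma on the proper filters below \<open>F\<close>: the infimum of a nonempty
  chain of them is proper, and a minimal one decides every \<open>P\<close>, since its restriction
  to \<open>P\<close> is either improper or the filter itself.\<close>

lemma ultrafilter_below:
  fixes F :: "'a filter"
  assumes "F \<noteq> bot"
  obtains p where "p \<le> F" "p \<noteq> bot"
    "\<And>P. eventually P p \<or> eventually (\<lambda>x. \<not> P x) p"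
proof -
  let ?A = "{G. G \<le> F \<and> G \<noteq> bot}"
  have "\<exists>m\<in>?A. \<forall>a\<in>?A. m \<ge> a \<longrightarrow> a = m"
  proof (rule predicate_Zorn)
    show "partial_order_on ?A (relation_of (\<ge>) ?A)"
      by (rule partial_order_on_relation_ofI) auto
    fix C assume "C \<in> Chains (relation_of (\<ge>) ?A)"
    then have C: "C \<subseteq> ?A" "\<And>G H. G \<in> C \<Longrightarrow> H \<in> C \<Longrightarrow> G \<le> H \<or> H \<le> G"
      by (auto simp: Chains_def relation_of_def)
    show "\<exists>u\<in>?A. \<forall>a\<in>C. a \<ge> u"
    proof (cases "C = {}")
      case True
      then show ?thesis using assms by auto
    next
      case False
      have "eventually P (Inf C) \<longleftrightarrow> (\<exists>G\<in>C. eventually P G)" for P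
        using False
      proof (rule eventually_Inf_base)
        fix G H assume GH: "G \<in> C" "H \<in> C"
        from C(2)[OF this] show "\<exists>x\<in>C. x \<le> inf G H"
          using GH by (elim disjE) (auto intro: bexI[of _ G] bexI[of _ H])
      qed
      then have "Inf C \<noteq> bot"
        using C(1) by (auto simp: trivial_limit_def)
      moreover have "Inf C \<le> F"
        using False C(1) by (auto intro: Inf_lower2)
      ultimately show ?thesis
        by (intro bexI[of _ "Inf C"]) (auto intro: Inf_lower)
    qed
  qed
  then obtain p where p: "p \<le> F" "p \<noteq> bot"
    and max: "\<And>G. G \<le> F \<Longrightarrow> G \<noteq> bot \<Longrightarrow> G \<le> p \<Longrightarrow> G = p"
    by auto
  have "eventually P p \<or> eventually (\<lambda>x. \<not> P x) p" for P
  proof (rule disjCI)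
    assume "\<not> eventually (\<lambda>x. \<not> P x) p"
    then have "inf p (principal {x. P x}) \<noteq> bot"
      by (simp add: trivial_limit_def eventually_inf_principal)
    then have "inf p (principal {x. P x}) = p"
      using p(1) by (intro max) (auto intro: le_infI1)
    then have "p \<le> principal {x. P x}"
      by (metis inf.cobounded2)
    then show "eventually P p"
      by (simp add: le_principal)
  qed
  with p show ?thesis using that by blast
qed

lemma ultrafilter_finite_range:
  assumes ultra: "\<And>P. eventually P p \<or> eventually (\<lambda>x. \<not> P x) p"
    and "finite S" "\<forall>\<^sub>F x in p. g x \<in> S" "p \<noteq> bot"
  shows "\<exists>a\<in>S. \<forall>\<^sub>F x in p. g x = a"
proof (rule ccontr)
  assume "\<not> ?thesis"
  then have "\<forall>a\<in>S. \<forall>\<^sub>F x in p. g x \<noteq> a"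
    using ultra by blast
  then have "\<forall>\<^sub>F x in p. \<forall>a\<in>S. g x \<noteq> a"
    using \<open>finite S\<close> by (simp add: eventually_ball_finite)
  then have "\<forall>\<^sub>F x in p. False"
    using assms(3) by eventually_elim blast
  then show False using \<open>p \<noteq> bot\<close> by simp
qed

section \<open>Iterated limits along a filter\<close>

text \<open>The Kowalsky sum of the filters \<open>G x\<close> along \<open>F\<close>; it encodes
  the nested quantifier "for almost all \<open>x\<close>, for almost all \<open>y\<close>".\<close>

definition bind_filter :: "'a filter \<Rightarrow> ('a \<Rightarrow> 'b filter) \<Rightarrow> 'b filter"
  where "bind_filter F G = Abs_filter (\<lambda>P. \<forall>\<^sub>F x in F. eventually P (G x))"

lemma eventually_bind_filter:
  fixes P :: "'b \<Rightarrow> bool"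
  shows "eventually P (bind_filter F G) \<longleftrightarrow> (\<forall>\<^sub>F x in F. eventually P (G x))"
  unfolding bind_filter_def
proof (rule eventually_Abs_filter, rule is_filter.intro)
  fix P Q :: "'b \<Rightarrow> bool"
  assume "\<forall>\<^sub>F x in F. eventually P (G x)" "\<forall>\<^sub>F x in F. eventually Q (G x)"
  then show "\<forall>\<^sub>F x in F. \<forall>\<^sub>F y in G x. P y \<and> Q y"
    by eventually_elim (rule eventually_conj)
next
  fix P Q :: "'b \<Rightarrow> bool"
  assume imp: "\<forall>x. P x \<longrightarrow> Q x" and "\<forall>\<^sub>F x in F. eventually P (G x)"
  from this(2) show "\<forall>\<^sub>F x in F. eventually Q (G x)"
    by eventually_elim (use imp in \<open>auto elim: eventually_mono\<close>)
qed simp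

text \<open>The \<open>n\<close>-fold Fubini power of \<open>p\<close>, on lists; the head is the
  outermost variable.\<close>

primrec iterated :: "'a filter \<Rightarrow> nat \<Rightarrow> 'a list filter" where
  "iterated p 0 = principal {[]}"
| "iterated p (Suc n) = bind_filter p (\<lambda>x. filtermap (Cons x) (iterated p n))"

lemma eventually_iterated_0: "eventually P (iterated p 0) \<longleftrightarrow> P []"
  by (simp add: eventually_principal)

lemma eventually_iterated_Suc:
  "eventually P (iterated p (Suc n)) \<longleftrightarrow> (\<forall>\<^sub>F x in p. \<forall>\<^sub>F xs in iterated p n. P (x # xs))"
  by (simp add: eventually_bind_filter eventually_filtermap)

declare iterated.simps [simp del]

lemma iterated_neq_bot: "p \<noteq> bot \<Longrightarrow> iterated p n \<noteq> bot"
  by (induction n)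
    (auto simp: trivial_limit_def eventually_iterated_0 eventually_iterated_Suc)

text \<open>The bound \<open>c\<close> varies in the induction because the tail has to lie above the
  head, which is chosen first.\<close>

lemma eventually_iterated_sorted_ge:
  fixes p :: "'a::linorder filter"
  assumes "p \<le> at_top"
  shows "\<forall>\<^sub>F xs in iterated p n. length xs = n \<and> sorted xs \<and> (\<forall>x\<in>set xs. c \<le> x)"
proof (induction n arbitrary: c)
  case 0
  then show ?case by (simp add: eventually_iterated_0)
next
  case (Suc n)
  have "\<forall>\<^sub>F x in p. c \<le> x"
    using assms by (rule filter_leD) simp
  then show ?case
    unfolding eventually_iterated_Suc
  proof eventually_elim
    case (elim x)
    from Suc[of x] show ?case
      by eventually_elim (use elim in auto)
  qed
qed

lemma eventually_iterated_sorted: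
  fixes p :: "'a::linorder filter"
  assumes "p \<le> at_top"
  shows "\<forall>\<^sub>F xs in iterated p n. length xs = n \<and> sorted xs"
  using eventually_iterated_sorted_ge[OF assms, of n undefined]
  by (rule eventually_mono) blast

fun every_second :: "'a list \<Rightarrow> 'a list" where
  "every_second (x # y # zs) = y # every_second zs"
| "every_second zs = []"

lemma length_every_second: "length (every_second xs) = length xs div 2"
  by (induction xs rule: every_second.induct) auto

lemma set_every_second: "set (every_second xs) \<subseteq> set xs"
  by (induction xs rule: every_second.induct) auto

text \<open>The variables dropped by \<open>every_second\<close> become vacuous quantifiers, and
  these disappear because \<open>p\<close> is proper.\<close>

lemma eventually_iterated_every_second:
  assumes "p \<noteq> bot"
  shows "(\<forall>\<^sub>F xs in iterated p (2 * n). P (every_second xs)) \<longleftrightarrow> eventually P (iterated p n)"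
proof (induction n arbitrary: P)
  case (Suc n)
  have "(\<forall>\<^sub>F xs in iterated p (2 * Suc n). P (every_second xs)) \<longleftrightarrow>
      (\<forall>\<^sub>F x in p. \<forall>\<^sub>F y in p. \<forall>\<^sub>F zs in iterated p (2 * n). P (y # every_second zs))"
    by (simp add: eventually_iterated_Suc)
  then show ?case
    using assms Suc[of "\<lambda>zs. P (y # zs)" for y] by (simp add: eventually_iterated_Suc)
qed (simp add: eventually_iterated_0)

section \<open>Countable ordinals and interlaced sequences\<close>

text \<open>The initial segments up to members of \<open>S\<close> are countable, so their countable
  union cannot exhaust the uncountable set of countable ordinals.\<close>

lemma countable_bounded:
  fixes S :: "countable_ordinal set"
  assumes "countable S"
  shows "\<exists>d. \<forall>s\<in>S. s < d"
proof -
  have "countable (Below ` {..s})" for s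
  proof (rule countable_subset)
    show "Below ` {..s} \<subseteq> insert (Below s) {..<Below s}"
      by (auto simp: less_ord_upto_omega1_def)
    show "countable (insert (Below s) {..<Below s})"
      using countable_below less_top_iff_Below by blast
  qed
  then have "countable (\<Union>s\<in>S. Below ` {..s})"
    using assms by blast
  moreover have "{..<top} = range Below"
    by (auto simp: less_top_iff_Below)
  ultimately have "(\<Union>s\<in>S. Below ` {..s}) \<noteq> range Below"
    using uncountable_below_top by metis
  then obtain d where "\<forall>s\<in>S. Below d \<notin> Below ` {..s}"
    by blast
  then show ?thesis
    by (auto simp: not_le image_iff)
qed

text \<open>The chain d1 \<le> c1 \<le> d2 \<le> c2 \<le> ... \<le> dn \<le> cn. Comparing
  \<open>c\<close> with all of \<open>ds\<close> instead of its head gives the same relation and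
  avoids a case split.\<close>

fun interlaced :: "'a::linorder list \<Rightarrow> 'a list \<Rightarrow> bool" where
  "interlaced [] [] \<longleftrightarrow> True"
| "interlaced (d # ds) (c # cs) \<longleftrightarrow> d \<le> c \<and> (\<forall>e\<in>set ds. c \<le> e) \<and> interlaced ds cs"
| "interlaced _ _ \<longleftrightarrow> False"

lemma interlaced_length: "interlaced ds cs \<Longrightarrow> length ds = length cs"
  by (induction ds cs rule: interlaced.induct) auto

lemma interlaced_lower_bound:
  "interlaced ds cs \<Longrightarrow> \<forall>d\<in>set ds. x \<le> d \<Longrightarrow> \<forall>c\<in>set cs. x \<le> c"
  by (induction ds cs rule: interlaced.induct) auto

text \<open>Prepending \<open>a\<close> shifts the common prefix by one place, so that the sorted
  list \<open>bs\<close> is interlaced with itself; \<open>g\<close> then fills the gap between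
  \<open>bs\<close> and \<open>ds\<close>.\<close>

lemma interlaced_append:
  assumes "sorted bs" "\<forall>b\<in>set bs. a \<le> b \<and> b \<le> g" "a \<le> g" "\<forall>d\<in>set ds. g \<le> d" "interlaced ds cs"
  shows "interlaced (a # bs @ ds) (bs @ g # cs)"
  using assms
proof (induction bs arbitrary: a)
  case (Cons b bs)
  then have "interlaced (b # bs @ ds) (bs @ g # cs)" by auto
  with Cons.prems show ?case by (auto intro: order_trans)
qed simp

text \<open>Induction on \<open>m\<close> with \<open>g\<close> and \<open>P\<close> varying: each
  \<open>j\<close> picks its own first entry above \<open>g\<close>, and \<open>g\<close> itself
  serves as first entry of the common sequence.\<close>

lemma countable_common_interlaced:
  fixes p :: "countable_ordinal filter"
  assumes p: "p \<le> at_top" "p \<noteq> bot"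
    and "countable J" "\<And>j. j \<in> J \<Longrightarrow> eventually (P j) (iterated p m)"
  shows "\<exists>ds. (\<forall>d\<in>set ds. g \<le> d) \<and> (\<forall>j\<in>J. \<exists>cs. P j cs \<and> interlaced ds cs)"
  using assms(4)
proof (induction m arbitrary: P g)
  case 0
  then show ?case
    by (intro exI[of _ "[]"]) (auto simp: eventually_iterated_0 intro!: exI[of _ "[]"])
next
  case (Suc m)
  have "\<forall>j\<in>J. \<exists>c. g \<le> c \<and> (\<forall>\<^sub>F cs in iterated p m. P j (c # cs))"
  proof
    fix j assume j: "j \<in> J"
    have "\<forall>\<^sub>F c in p. g \<le> c"
      using p(1) by (rule filter_leD) simp
    with Suc.prems[OF j] have
      "\<forall>\<^sub>F c in p. g \<le> c \<and> (\<forall>\<^sub>F cs in iterated p m. P j (c # cs))"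
      by (simp add: eventually_iterated_Suc eventually_conj)
    then show "\<exists>c. g \<le> c \<and> (\<forall>\<^sub>F cs in iterated p m. P j (c # cs))"
      by (rule eventually_happens'[OF p(2)])
  qed
  from bchoice[OF this] obtain c where
    c: "\<forall>j\<in>J. g \<le> c j \<and> (\<forall>\<^sub>F cs in iterated p m. P j (c j # cs))" ..
  \<comment> \<open>Countability of \<open>J\<close> enters here: the rest of the common sequence
    can be placed above all the entries \<open>c j\<close> at once.\<close>
  have "\<exists>h. \<forall>s\<in>c ` J. s < h"
    using \<open>countable J\<close> by (intro countable_bounded countable_image)
  then obtain h where h: "\<forall>j\<in>J. c j < h" by auto
  have "\<exists>ds. (\<forall>d\<in>set ds. max g h \<le> d) \<and> (\<forall>j\<in>J. \<exists>cs. P j (c j # cs) \<and> interlaced ds cs)"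
    by (rule Suc.IH) (use c in auto)
  then obtain ds where ds: "\<forall>d\<in>set ds. max g h \<le> d"
    "\<forall>j\<in>J. \<exists>cs. P j (c j # cs) \<and> interlaced ds cs" by auto
  have "\<exists>cs. P j cs \<and> interlaced (g # ds) cs" if j: "j \<in> J" for j
  proof -
    obtain cs where cs: "P j (c j # cs)" "interlaced ds cs"
      using bspec[OF ds(2) j] by auto
    have "g \<le> c j" using bspec[OF c j] ..
    moreover have "c j < h" using bspec[OF h j] .
    then have "\<forall>e\<in>set ds. c j \<le> e" using ds(1) by fastforce
    ultimately have "interlaced (g # ds) (c j # cs)" using cs(2) by simp
    with cs(1) show ?thesis by blast
  qed
  moreover have "\<forall>d\<in>set (g # ds). g \<le> d" using ds(1) by simp
  ultimately show ?case by blast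
qed

section \<open>Step functions\<close>

definition count_ge :: "ord_upto_omega1 \<Rightarrow> countable_ordinal list \<Rightarrow> nat"
  where "count_ge x bs = length (filter (\<lambda>b. x \<le> Below b) bs)"

lemma count_ge_simps [simp]:
  "count_ge x [] = 0"
  "count_ge x (b # bs) = (if x \<le> Below b then Suc (count_ge x bs) else count_ge x bs)"
  by (simp_all add: count_ge_def)

lemma count_ge_eq_length: "\<forall>b\<in>set bs. x \<le> Below b \<Longrightarrow> count_ge x bs = length bs"
  by (simp add: count_ge_def)

text \<open>Along the chain d1 \<le> c1 \<le> d2 \<le> ... the entries that are at least
  \<open>x\<close> form a final segment; it starts with some d, giving equal counts, or with some c,
  giving one surplus.\<close>

lemma count_ge_interlaced:
  assumes "interlaced ds cs"
  shows "count_ge x ds \<le> count_ge x cs" "count_ge x cs \<le> Suc (count_ge x ds)"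
proof -
  have "count_ge x ds \<le> count_ge x cs \<and> count_ge x cs \<le> Suc (count_ge x ds)"
    using assms
  proof (induction ds cs rule: interlaced.induct)
    case (2 d ds c cs)
    then have IH: "count_ge x ds \<le> count_ge x cs" "count_ge x cs \<le> Suc (count_ge x ds)"
      and d: "d \<le> c" "\<forall>e\<in>set ds. c \<le> e" and il: "interlaced ds cs"
      by auto
    have le: "x \<le> Below a \<Longrightarrow> a \<le> b \<Longrightarrow> x \<le> Below b" for a b
      by (meson less_eq_ord_upto_omega1.simps(1) order_trans)
    have "count_ge x ds = count_ge x cs" if "x \<le> Below c"
    proof -
      have "\<forall>e\<in>set cs. c \<le> e"
        using interlaced_lower_bound[OF il d(2)] .
      then show ?thesis
        using that d(2) le interlaced_length[OF il] by (simp add: count_ge_eq_length)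
    qed
    then show ?case using IH d(1) le by auto
  qed auto
  then show "count_ge x ds \<le> count_ge x cs" "count_ge x cs \<le> Suc (count_ge x ds)"
    by auto
qed

text \<open>The entries that are at least \<open>x\<close> form a final segment of
  \<open>bs\<close>. As the last entry is kept, a segment of length k contains k/2 kept entries,
  rounded up.\<close>

lemma count_ge_every_second:
  assumes "sorted bs" "even (length bs)"
  shows "count_ge x bs \<le> 2 * count_ge x (every_second bs)"
    "2 * count_ge x (every_second bs) \<le> Suc (count_ge x bs)"
proof -
  have "count_ge x bs \<le> 2 * count_ge x (every_second bs) \<and>
      2 * count_ge x (every_second bs) \<le> Suc (count_ge x bs)"
    using assms
  proof (induction bs rule: every_second.induct)
    case (1 a b bs)
    have le: "x \<le> Below a \<Longrightarrow> a \<le> b \<Longrightarrow> x \<le> Below b" for a b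
      by (meson less_eq_ord_upto_omega1.simps(1) order_trans)
    have "2 * count_ge x (every_second bs) = count_ge x bs" if "x \<le> Below b"
    proof -
      have "\<forall>e\<in>set bs. x \<le> Below e"
        using that 1 le by auto
      then show ?thesis
        using 1 set_every_second[of bs]
        by (auto simp: count_ge_eq_length length_every_second subset_iff)
    qed
    then show ?case using 1 le[of a b] by auto
  qed auto
  then show "count_ge x bs \<le> 2 * count_ge x (every_second bs)"
    "2 * count_ge x (every_second bs) \<le> Suc (count_ge x bs)" by auto
qed

definition step :: "countable_ordinal list \<Rightarrow> ord_upto_omega1 \<Rightarrow>\<^sub>C real"
  where "step bs = Bcontfun (\<lambda>x. real (count_ge x bs) / real (length bs))"

lemma continuous_on_indicator_Below:
  "continuous_on UNIV (\<lambda>x. of_bool (x \<le> Below b) :: real)"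
proof -
  \<comment> \<open>\<open>s\<close> is the successor of \<open>Below b\<close>, so the indicator is
    constant on each of two complementary closed sets.\<close>
  define s where "s = (LEAST y. Below b < y)"
  have "Below b < top" by (auto simp: less_top_iff_Below)
  then have "Below b < s" unfolding s_def by (rule LeastI)
  moreover have "Below b < y \<Longrightarrow> s \<le> y" for y unfolding s_def by (rule Least_le)
  ultimately have s: "x \<le> Below b \<longleftrightarrow> x < s" for x
    by (meson leD leI le_less_trans)
  have "continuous_on ({..Below b} \<union> {s..}) (\<lambda>x. of_bool (x \<le> Below b) :: real)"
  proof (rule continuous_on_closed_Un)
    show "continuous_on {..Below b} (\<lambda>x. of_bool (x \<le> Below b) :: real)"
      by (rule continuous_on_eq[of _ "\<lambda>_. 1"]) auto
    show "continuous_on {s..} (\<lambda>x. of_bool (x \<le> Below b) :: real)"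
      by (rule continuous_on_eq[of _ "\<lambda>_. 0"]) (auto simp: s)
  qed auto
  moreover have "{..Below b} \<union> {s..} = UNIV" by (auto simp: s)
  ultimately show ?thesis by simp
qed

lemma apply_step: "apply_bcontfun (step bs) x = real (count_ge x bs) / real (length bs)"
proof -
  have "continuous_on UNIV (\<lambda>x. real (count_ge x bs))"
  proof (induction bs)
    case (Cons b bs)
    have "(\<lambda>x. real (count_ge x (b # bs))) = (\<lambda>x. of_bool (x \<le> Below b) + real (count_ge x bs))"
      by auto
    then show ?case
      using continuous_on_add[OF continuous_on_indicator_Below[of b] Cons] by (simp only:)
  qed simp
  then have "continuous_on UNIV (\<lambda>x. real (count_ge x bs) / real (length bs))"
    by (cases "bs = []") (auto intro!: continuous_intros)
  then show ?thesis
    unfolding step_def by (subst Bcontfun_inverse) (auto intro: continuous_imp_bcontfun)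
qed

lemma step_in_M:
  assumes "bs \<noteq> []"
  shows "step bs \<in> M"
  unfolding M_def
proof (intro CollectI conjI antimonoI)
  fix x y :: ord_upto_omega1 assume "x \<le> y"
  then have "count_ge y bs \<le> count_ge x bs"
    by (induction bs) auto
  then show "apply_bcontfun (step bs) y \<le> apply_bcontfun (step bs) x"
    by (simp add: apply_step divide_right_mono)
next
  show "apply_bcontfun (step bs) bot = 1"
    using assms by (simp add: apply_step count_ge_eq_length)
  have "count_ge top bs = 0"
    by (induction bs) (auto simp: top_ord_upto_omega1_def)
  then show "apply_bcontfun (step bs) top = 0"
    by (simp add: apply_step)
qed

lemma dist_step_interlaced:
  assumes "interlaced ds cs"
  shows "dist (step cs) (step ds) \<le> 1 / length cs"
proof (rule dist_bound)
  fix x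
  have "\<bar>real (count_ge x cs) - real (count_ge x ds)\<bar> \<le> 1"
    using count_ge_interlaced[OF assms, of x] by linarith
  then show "dist (apply_bcontfun (step cs) x) (apply_bcontfun (step ds) x) \<le> 1 / length cs"
    using interlaced_length[OF assms]
    by (simp add: apply_step dist_real_def flip: diff_divide_distrib)
      (simp add: divide_right_mono)
qed

lemma dist_step_every_second:
  assumes "sorted bs" "even (length bs)"
  shows "dist (step (every_second bs)) (step bs) \<le> 1 / length bs"
proof (rule dist_bound)
  fix x
  have len: "real (length bs) = 2 * real (length (every_second bs))"
    using assms(2) by (simp add: length_every_second real_of_nat_div)
  have "apply_bcontfun (step (every_second bs)) x = real (2 * count_ge x (every_second bs)) / length bs"
    by (simp add: apply_step len)
  moreover have "\<bar>real (2 * count_ge x (every_second bs)) - real (count_ge x bs)\<bar> \<le> 1"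
    using count_ge_every_second[OF assms, of x] by linarith
  ultimately show "dist (apply_bcontfun (step (every_second bs)) x) (apply_bcontfun (step bs) x)
      \<le> 1 / length bs"
    by (simp add: apply_step dist_real_def flip: diff_divide_distrib)
      (simp add: divide_right_mono)
qed

section \<open>The Cauchy filter\<close>

text \<open>
  The prefix \<open>bs\<close> is fixed and \<open>m\<close> counts the variables eliminated so far. The function
  \<open>step (a # bs @ ds)\<close>, with \<open>a\<close> the least ordinal, is the single point lying in all the members
  selected for the sequences \<open>bs @ \<gamma> # cs\<close>.
\<close>

lemma selection_eventually_constant:
  assumes p: "p \<le> at_top" "p \<noteq> bot" "\<And>P. eventually P p \<or> eventually (\<lambda>x. \<not> P x) p"
    and fin: "point_finite M D"
    and sel: "\<And>bs f. bs \<noteq> [] \<Longrightarrow> length bs = n \<Longrightarrow> f \<in> M \<Longrightarrow> dist (step bs) f \<le> 1 / n \<Longrightarrow> f \<in> A bs"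
    and AD: "\<And>bs. bs \<noteq> [] \<Longrightarrow> A bs \<in> D"
    and "sorted bs" "length bs + m = n"
  shows "\<exists>A\<^sub>0. \<forall>\<^sub>F cs in iterated p m. A (bs @ cs) = A\<^sub>0"
  using assms(7,8)
proof (induction m arbitrary: bs)
  case 0
  then show ?case by (simp add: eventually_iterated_0)
next
  case (Suc m)
  obtain b where b: "\<forall>a\<in>set bs. a < b"
    using countable_bounded[of "set bs"] by (auto intro: countable_finite)
  define \<Gamma> where "\<Gamma> = {b..}"
  have "\<forall>\<gamma>\<in>\<Gamma>. \<exists>B. \<forall>\<^sub>F cs in iterated p m. A (bs @ \<gamma> # cs) = B"
  proof
    fix \<gamma> assume "\<gamma> \<in> \<Gamma>"
    then have "sorted (bs @ [\<gamma>])"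
      using Suc.prems b by (force simp: sorted_append \<Gamma>_def)
    then show "\<exists>B. \<forall>\<^sub>F cs in iterated p m. A (bs @ \<gamma> # cs) = B"
      using Suc.IH[of "bs @ [\<gamma>]"] Suc.prems by simp
  qed
  from bchoice[OF this] obtain B where
    B: "\<forall>\<gamma>\<in>\<Gamma>. \<forall>\<^sub>F cs in iterated p m. A (bs @ \<gamma> # cs) = B \<gamma>" ..
  have "finite (B ` \<Gamma>)"
  proof (rule ccontr)
    assume "infinite (B ` \<Gamma>)"
    \<comment> \<open>A countable infinite set of values suffices for the contradiction, and its
      index set \<open>J\<close> is bounded.\<close>
    then obtain T where T: "T \<subseteq> B ` \<Gamma>" "infinite T" "countable T"
      by (meson infinite_countable_subset')
    then obtain J where J: "J \<subseteq> \<Gamma>" "countable J" "B ` J = T"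
      by (metis countable_subset_image)
    obtain g where g: "\<forall>\<gamma>\<in>J. \<gamma> < g"
      using countable_bounded[OF J(2)] ..
    obtain ds where ds: "\<forall>d\<in>set ds. g \<le> d"
      "\<forall>\<gamma>\<in>J. \<exists>cs. A (bs @ \<gamma> # cs) = B \<gamma> \<and> length cs = m \<and> interlaced ds cs"
    proof -
      have "\<forall>\<^sub>F cs in iterated p m. A (bs @ \<gamma> # cs) = B \<gamma> \<and> length cs = m" if "\<gamma> \<in> J" for \<gamma>
        using B[rule_format, of \<gamma>, OF subsetD[OF J(1) that]]
          eventually_iterated_sorted[OF p(1), of m]
        by eventually_elim auto
      from countable_common_interlaced[OF p(1,2) J(2) this] show ?thesis
        using that by force
    qed
    \<comment> \<open>The least ordinal makes room for the shift of the prefix \<open>bs\<close>,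
      and it brings the length of \<open>a # bs @ ds\<close> to \<open>n\<close>.\<close>
    define a :: countable_ordinal where "a = (LEAST a. True)"
    have a: "a \<le> c" for c unfolding a_def by (simp add: Least_le)
    define f where "f = step (a # bs @ ds)"
    have "B \<gamma> \<in> {A \<in> D. f \<in> A}" if \<gamma>: "\<gamma> \<in> J" for \<gamma>
    proof -
      obtain cs where cs: "A (bs @ \<gamma> # cs) = B \<gamma>" "length cs = m" "interlaced ds cs"
        using ds(2) \<gamma> by blast
      have "b \<le> \<gamma>" using J(1) \<gamma> by (auto simp: \<Gamma>_def)
      then have "\<forall>a\<in>set bs. a \<le> \<gamma>" using b by fastforce
      then have "interlaced (a # bs @ ds) (bs @ \<gamma> # cs)"
        using Suc.prems a cs(3) ds(1) bspec[OF g \<gamma>]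
        by (intro interlaced_append) (auto intro: order_trans less_imp_le)
      from dist_step_interlaced[OF this] have "f \<in> A (bs @ \<gamma> # cs)"
        using Suc.prems cs(2) unfolding f_def by (intro sel step_in_M) auto
      then show ?thesis using cs(1) AD[of "bs @ \<gamma> # cs"] by simp
    qed
    then have "T \<subseteq> {A \<in> D. f \<in> A}" using J(3) by blast
    moreover have "finite {A \<in> D. f \<in> A}"
      using fin unfolding point_finite_def f_def by (simp add: step_in_M)
    ultimately show False using T(2) finite_subset by blast
  qed
  moreover have ev: "\<forall>\<^sub>F \<gamma> in p. \<gamma> \<in> \<Gamma>"
    using p(1) unfolding \<Gamma>_def by (intro filter_leD[of p at_top]) auto
  moreover from ev have "\<forall>\<^sub>F \<gamma> in p. B \<gamma> \<in> B ` \<Gamma>"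
    by eventually_elim simp
  ultimately obtain A\<^sub>0 where "\<forall>\<^sub>F \<gamma> in p. B \<gamma> = A\<^sub>0"
    using ultrafilter_finite_range[of p "B ` \<Gamma>" B] p by blast
  with ev have "\<forall>\<^sub>F \<gamma> in p. \<forall>\<^sub>F cs in iterated p m. A (bs @ \<gamma> # cs) = A\<^sub>0"
    by eventually_elim (use B in auto)
  then show ?case by (auto simp: eventually_iterated_Suc)
qed

text \<open>With powers of two, each stage has twice as many steps as the one before, so
  \<open>every_second\<close> leads back to the previous stage.\<close>

definition step_filter :: "countable_ordinal filter \<Rightarrow> (ord_upto_omega1 \<Rightarrow>\<^sub>C real) filter"
  where "step_filter p = bind_filter sequentially (\<lambda>k. filtermap step (iterated p (2 ^ k)))"

lemma eventually_step_filter: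
  "eventually P (step_filter p) \<longleftrightarrow>
    (\<forall>\<^sub>F k in sequentially. \<forall>\<^sub>F bs in iterated p (2 ^ k). P (step bs))"
  by (simp add: step_filter_def eventually_bind_filter eventually_filtermap)

text \<open>One stage decides all later ones: halving the list moves the step function by at most
  1/2^(j+1), so the ball of radius 1/2^(j+1) at stage j+1 lies in the ball of radius 1/2^j at stage
  j.\<close>

lemma eventually_step_filterI:
  assumes p: "p \<le> at_top" "p \<noteq> bot"
    and "\<forall>\<^sub>F bs in iterated p (2 ^ k). \<forall>f\<in>M. dist (step bs) f \<le> 1 / 2 ^ k \<longrightarrow> f \<in> A"
  shows "\<forall>\<^sub>F f in step_filter p. f \<in> A"
proof -
  have ball: "\<forall>\<^sub>F bs in iterated p (2 ^ j). \<forall>f\<in>M. dist (step bs) f \<le> 1 / 2 ^ j \<longrightarrow> f \<in> A"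
    if "k \<le> j" for j
    using that
  proof (induction j rule: dec_induct)
    case (step j)
    have "\<forall>\<^sub>F bs in iterated p (2 ^ Suc j).
        \<forall>f\<in>M. dist (step (every_second bs)) f \<le> 1 / 2 ^ j \<longrightarrow> f \<in> A"
      using step.IH eventually_iterated_every_second[OF p(2), of
          "\<lambda>bs. \<forall>f\<in>M. dist (step bs) f \<le> 1 / 2 ^ j \<longrightarrow> f \<in> A" "2 ^ j"] by simp
    with eventually_iterated_sorted[OF p(1), of "2 ^ Suc j"] show ?case
    proof eventually_elim
      case (elim bs)
      have d: "dist (step (every_second bs)) (step bs) \<le> 1 / 2 ^ Suc j"
        using dist_step_every_second[of bs] elim(1) by simp
      show ?case
      proof (intro ballI impI)
        fix f assume "f \<in> M" "dist (step bs) f \<le> 1 / 2 ^ Suc j"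
        moreover have "dist (step (every_second bs)) f \<le>
            dist (step (every_second bs)) (step bs) + dist (step bs) f"
          by (rule dist_triangle)
        moreover have "(1::real) / 2 ^ j = 1 / 2 ^ Suc j + 1 / 2 ^ Suc j"
          by simp
        ultimately have "dist (step (every_second bs)) f \<le> 1 / 2 ^ j"
          using d by linarith
        with \<open>f \<in> M\<close> show "f \<in> A" using elim(2) by blast
      qed
    qed
  qed (rule assms)
  have "\<forall>\<^sub>F bs in iterated p (2 ^ j). step bs \<in> A" if "k \<le> j" for j
    using ball[OF that] eventually_iterated_sorted[OF p(1), of "2 ^ j"]
  proof eventually_elim
    case (elim bs)
    then have "step bs \<in> M" by (intro step_in_M) auto
    with elim(1) show ?case by simp
  qed
  then show ?thesis
    unfolding eventually_step_filter eventually_sequentially by blast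
qed

lemma step_filter_neq_bot: "p \<noteq> bot \<Longrightarrow> step_filter p \<noteq> bot"
  by (simp add: trivial_limit_def eventually_step_filter)
    (simp flip: trivial_limit_def add: iterated_neq_bot)

lemma step_filter_le: "p \<le> at_top \<Longrightarrow> step_filter p \<le> principal M"
  unfolding le_principal eventually_step_filter
  by (rule always_eventually, rule allI, rule eventually_mono[OF eventually_iterated_sorted])
    (auto intro: step_in_M)

lemma step_filter_cauchy:
  assumes p: "p \<le> at_top" "p \<noteq> bot" "\<And>P. eventually P p \<or> eventually (\<lambda>x. \<not> P x) p"
    and D: "point_finite M D" "D \<in> metric_uniform_structure M"
  shows "\<exists>A\<in>D. \<forall>\<^sub>F f in step_filter p. f \<in> A"
proof -
  obtain e where e: "e > 0" "\<forall>x\<in>M. \<exists>A\<in>D. M \<inter> ball x e \<subseteq> A"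
    using D(2) by (auto simp: metric_uniform_structure_def)
  \<comment> \<open>The strict inequality puts the closed ball of radius 1/2^k inside the open ball
    of radius \<open>e\<close>.\<close>
  obtain k where "(1 / 2) ^ k < e"
    using real_arch_pow_inv[OF e(1), of "1 / 2"] by auto
  then have k: "1 / 2 ^ k < e" by (simp add: power_divide)
  have "\<forall>bs. \<exists>A. bs \<noteq> [] \<longrightarrow> A \<in> D \<and> M \<inter> ball (step bs) e \<subseteq> A"
    using e(2) step_in_M by blast
  then obtain A where A: "\<And>bs. bs \<noteq> [] \<Longrightarrow> A bs \<in> D"
    "\<And>bs. bs \<noteq> [] \<Longrightarrow> M \<inter> ball (step bs) e \<subseteq> A bs"
    by metis
  have sel: "f \<in> A bs" if "bs \<noteq> []" "f \<in> M" "dist (step bs) f \<le> 1 / 2 ^ k" for bs f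
    using A(2)[OF that(1)] that k by auto
  \<comment> \<open>With the empty prefix, all 2^k variables are eliminated.\<close>
  have "\<exists>A\<^sub>0. \<forall>\<^sub>F cs in iterated p (2 ^ k). A ([] @ cs) = A\<^sub>0"
    by (rule selection_eventually_constant[OF p D(1), where n = "2 ^ k"]) (auto intro: sel A(1))
  then obtain A\<^sub>0 where "\<forall>\<^sub>F cs in iterated p (2 ^ k). A cs = A\<^sub>0" by auto
  with eventually_iterated_sorted[OF p(1), of "2 ^ k"]
  have *: "\<forall>\<^sub>F cs in iterated p (2 ^ k). A cs = A\<^sub>0 \<and> cs \<noteq> []"
    by eventually_elim auto
  then have "A\<^sub>0 \<in> D"
    using eventually_happens'[OF iterated_neq_bot[OF p(2)]] A(1) by blast
  moreover from * have
    "\<forall>\<^sub>F cs in iterated p (2 ^ k). \<forall>f\<in>M. dist (step cs) f \<le> 1 / 2 ^ k \<longrightarrow> f \<in> A\<^sub>0"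
    by eventually_elim (use sel in blast)
  ultimately show ?thesis
    using eventually_step_filterI[OF p(1,2)] by blast
qed

section \<open>Failure of convergence in \<open>M\<close>\<close>

text \<open>For almost all lists every entry is at least \<open>c\<close>, so all the averaged
  intervals contain \<open>Below c\<close>.\<close>

lemma eventually_step_filter_eq_1:
  assumes "p \<le> at_top"
  shows "\<forall>\<^sub>F f in step_filter p. apply_bcontfun f (Below c) = 1"
  unfolding eventually_step_filter
proof (rule always_eventually, rule allI)
  fix k
  from eventually_iterated_sorted_ge[OF assms, of "2 ^ k" c]
  show "\<forall>\<^sub>F bs in iterated p (2 ^ k). apply_bcontfun (step bs) (Below c) = 1"
    by eventually_elim (auto simp: apply_step count_ge_eq_length)
qed

text \<open>As \<open>f\<close> vanishes at \<open>top\<close>, continuity makes it small on some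
  interval from \<open>y\<close> (exclusive) to \<open>top\<close>, and this contains a countable
  ordinal because none is the largest.\<close>

lemma M_small_below_top:
  assumes "f \<in> M"
  obtains c where "apply_bcontfun f (Below c) < 1 / 2"
proof -
  have "open (apply_bcontfun f -` {..<1/2})"
    using continuous_on_apply_bcontfun[of UNIV f] by (intro open_vimage) auto
  moreover have "top \<in> apply_bcontfun f -` {..<1/2}"
    using assms by (simp add: M_def)
  moreover have "Below (LEAST a. True) < top"
    by (auto simp: less_top_iff_Below)
  ultimately obtain y where y: "y < top" "{y<..top} \<subseteq> apply_bcontfun f -` {..<1/2}"
    using open_left by blast
  then obtain a where a: "y = Below a" using less_top_iff_Below by blast
  obtain c where "a < c" using countable_bounded[of "{a}"] by auto
  then have "Below c \<in> {y<..top}"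
    by (auto simp: a less_ord_upto_omega1_def)
  then show ?thesis using y(2) that by auto
qed

theorem mainTheorem1:
  fixes U :: "(ord_upto_omega1 \<Rightarrow>\<^sub>C real) set set set"
  assumes "uniform_structure_on M U"
    and "uniform_topology M U = top_of_set M"
    and "finer_uniform_structure (metric_uniform_structure M) U"
    and "\<exists>B. uniformity_basis U B \<and> (\<forall>C\<in>B. point_finite M C)"
  shows "\<not> complete_uniform_structure M U"
proof
  assume complete: "complete_uniform_structure M U"
  obtain p :: "countable_ordinal filter" where p: "p \<le> at_top" "p \<noteq> bot"
    "\<And>P. eventually P p \<or> eventually (\<lambda>x. \<not> P x) p"
    using ultrafilter_below[OF trivial_limit_at_top_linorder] by blast
  have "cauchy_filter_on M U (step_filter p)"
    unfolding cauchy_filter_on_def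
  proof (intro conjI ballI)
    fix C assume "C \<in> U"
    \<comment> \<open>Point-finiteness comes from the basis, the Lebesgue number from the metric
      uniformity being finer than \<open>U\<close>.\<close>
    then obtain D where D: "D \<in> U" "point_finite M D" "refines D C"
      using assms(4) unfolding uniformity_basis_def by (meson subsetD)
    then have "D \<in> metric_uniform_structure M"
      using assms(3) by (auto simp: finer_uniform_structure_def)
    from step_filter_cauchy[OF p D(2) this]
    obtain A where "A \<in> D" "\<forall>\<^sub>F f in step_filter p. f \<in> A" by blast
    moreover from this D(3) obtain B where "B \<in> C" "A \<subseteq> B" unfolding refines_def by blast
    ultimately show "\<exists>A\<in>C. \<forall>\<^sub>F f in step_filter p. f \<in> A"
      by (auto intro!: bexI[of _ B] elim: eventually_mono)
  qed (use p step_filter_neq_bot step_filter_le in auto)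
  then obtain l where "limitin (top_of_set M) (\<lambda>f. f) l (step_filter p)"
    using complete assms(2) unfolding complete_uniform_structure_def by metis
  then have l: "l \<in> M" and lim: "\<And>V. open V \<Longrightarrow> l \<in> V \<Longrightarrow> \<forall>\<^sub>F f in step_filter p. f \<in> V"
    by (auto simp: limitin_subtopology limitin_canonical_iff tendsto_def)
  obtain c where c: "apply_bcontfun l (Below c) < 1 / 2"
    using M_small_below_top[OF l] .
  \<comment> \<open>At \<open>Below c\<close> the limit is below 1/2 while almost all
    \<open>f\<close> have the value 1, so their distance exceeds 1/2.\<close>
  have "\<forall>\<^sub>F f in step_filter p. f \<in> ball l (1 / 2)"
    by (rule lim) auto
  then have "\<forall>\<^sub>F f in step_filter p. False"
    using eventually_step_filter_eq_1[OF p(1), of c]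
  proof eventually_elim
    case (elim f)
    then have "dist (apply_bcontfun l (Below c)) (apply_bcontfun f (Below c)) < 1 / 2"
      using dist_bounded[of l "Below c" f] by simp
    with c elim(2) show ?case by (simp add: dist_real_def)
  qed
  then show False using step_filter_neq_bot[OF p(2)] by simp
qed

end
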